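(* For each pair $(a,b)\in[0,\infty]^2$ with $a\le b$, there exists a Cantor metric space $(X,d)$ with \[ \dim_H(X,d)=a,\qquad \dim_A(X,d)=b, \] where $\dim_H$ is the Hausdorff dimension and $\dim_A$ is the Assouad dimension.
   Context: A Cantor metric space is a metric space homeomorphic to the middle-third Cantor set. $\dim_H$ is the usual Hausdorff dimension. Assouad dimension: for a metric space $(X,d)$ and $\epsilon\in(0,2)$ let $\mathcal{N}(\epsilon)\in\mathbb{N}\cup\{\infty\}$ be the infimum of those $N\in\mathbb{N}$ such that every closed metric ball of radius $r$ (any $r>0$) can be covered by at most $N$ closed metric balls of radius $\epsilon r$. Then $\dim_A(X,d)$ is the infimum of all $s\in(0,\infty)$ for which there exists $K\in(0,\infty)$ with $\mathcal{N}(\epsilon)\le K\epsilon^{-s}$ for all $\epsilon\in(0,2)$ (and $\infty$ if there is no such $s$). *)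

theory Defs
  imports "HOL-Analysis.Analysis"
begin

primrec cantor_stage :: "nat \<Rightarrow> real set" where
  "cantor_stage 0 = {0..1}"
| "cantor_stage (Suc n) = (\<lambda>x. x / 3) ` cantor_stage n \<union> (\<lambda>x. 2 / 3 + x / 3) ` cantor_stage n"

definition cantor_set :: "real set" where
  "cantor_set = (\<Inter>n. cantor_stage n)"

definition cantor_metric_space :: "'a metric \<Rightarrow> bool" where
  "cantor_metric_space m \<longleftrightarrow> mtopology_of m homeomorphic_space top_of_set cantor_set"

definition mdiam :: "'a metric \<Rightarrow> 'a set \<Rightarrow> ennreal" where
  "mdiam m U = (SUP x\<in>U. SUP y\<in>U. ennreal (mdist m x y))"

text \<open>The weight of a set of finite diameter is its diameter to the power \<open>s\<close>. The case
  distinction implements the usual conventions that the empty set has weight \<open>0\<close> and that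
  \<open>0\<close> to the power \<open>0\<close> is \<open>1\<close> (whereas \<open>0 powr 0 = 0\<close>), so that the 0-dimensional
  measure is the counting measure.\<close>

definition hausdorff_weight :: "'a metric \<Rightarrow> real \<Rightarrow> 'a set \<Rightarrow> ennreal" where
  "hausdorff_weight m s U =
     (if U = {} then 0
      else if s = 0 then 1
      else ennreal (enn2real (mdiam m U) powr s))"

text \<open>Finite covers are included, since members of the sequence may be empty.\<close>

definition hausdorff_premeasure :: "'a metric \<Rightarrow> real \<Rightarrow> real \<Rightarrow> 'a set \<Rightarrow> ennreal" where
  "hausdorff_premeasure m s \<delta> A =
     Inf {(\<Sum>n. hausdorff_weight m s (U n)) | U :: nat \<Rightarrow> 'a set.
            (\<forall>n. U n \<subseteq> mspace m \<and> mdiam m (U n) \<le> ennreal \<delta>) \<and> A \<subseteq> (\<Union>n. U n)}"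

definition hausdorff_measure :: "'a metric \<Rightarrow> real \<Rightarrow> 'a set \<Rightarrow> ennreal" where
  "hausdorff_measure m s A = (SUP \<delta>\<in>{0<..}. hausdorff_premeasure m s \<delta> A)"

text \<open>In \<open>ennreal\<close> and \<open>enat\<close> the infimum of the empty set is \<open>\<infinity>\<close>.\<close>

definition hausdorff_dim :: "'a metric \<Rightarrow> ennreal" where
  "hausdorff_dim m = Inf {ennreal s | s. 0 \<le> s \<and> hausdorff_measure m s (mspace m) = 0}"

definition covering_number :: "'a metric \<Rightarrow> real \<Rightarrow> enat" where
  "covering_number m \<epsilon> =
     Inf {enat N | N. \<forall>x\<in>mspace m. \<forall>r>0.
            \<exists>C\<subseteq>mspace m. finite C \<and> card C \<le> N \<and>
              mcball_of m x r \<subseteq> (\<Union>c\<in>C. mcball_of m c (\<epsilon> * r))}"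

definition assouad_dim :: "'a metric \<Rightarrow> ennreal" where
  "assouad_dim m =
     Inf {ennreal s | s. 0 < s \<and>
            (\<exists>K>0. \<forall>\<epsilon>\<in>{0<..<2}.
               ennreal_of_enat (covering_number m \<epsilon>) \<le> ennreal (K * \<epsilon> powr (- s)))}"

end

theory Submission
  imports Defs "HOL-Probability.Infinite_Product_Measure" "HOL-Probability.Probability_Mass_Function"
    "HOL-Real_Asymp.Real_Asymp"
begin

text \<open>Give the space of binary sequences the ultrametric in which two sequences that first differ at
  index \<open>k\<close> have distance \<open>2 powr - p k\<close>, where \<open>p\<close> increases strictly to infinity. Its balls are
  the cylinders, so its Hausdorff dimension is the lower limit of \<open>k / p k\<close> (the coin-tossing measure
  gives the lower bound), and its Assouad dimension is the upper limit of \<open>n / (p (j + n) - p j)\<close> as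
  \<open>n\<close> grows, uniformly in \<open>j\<close>. Ternary expansion identifies the space with the Cantor set. Take the
  increments of \<open>p\<close> close to \<open>1 / a\<close>, except on blocks of growing length \<open>n\<close>, where they are close to
  \<open>1 / b\<close>. The blocks begin at the positions \<open>2 ^ n\<close>, so they are too sparse to affect the
  Hausdorff dimension, but long enough to raise the Assouad dimension to \<open>b\<close>.\<close>

section \<open>Ternary coding of the Cantor set\<close>

definition first_diff :: "(nat \<Rightarrow> bool) \<Rightarrow> (nat \<Rightarrow> bool) \<Rightarrow> nat" where
  "first_diff c c' = (LEAST i. c i \<noteq> c' i)"

lemma first_diff_neq: "c i \<noteq> c' i \<Longrightarrow> c (first_diff c c') \<noteq> c' (first_diff c c')"
  unfolding first_diff_def by (rule LeastI)

lemma first_diff_le: "c i \<noteq> c' i \<Longrightarrow> first_diff c c' \<le> i"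
  unfolding first_diff_def by (rule Least_le)

lemma eq_before_first_diff: "i < first_diff c c' \<Longrightarrow> c i = c' i"
  unfolding first_diff_def by (drule not_less_Least) simp

lemma first_diff_commute: "first_diff c c' = first_diff c' c"
  by (simp add: first_diff_def eq_commute)

definition ternary :: "(nat \<Rightarrow> bool) \<Rightarrow> real" where
  "ternary c = (\<Sum>i. 2 * of_bool (c i) / 3 ^ Suc i)"

lemma summable_ternary: "summable (\<lambda>i. 2 * of_bool (c i) / 3 ^ Suc i :: real)"
proof (rule summable_comparison_test')
  show "summable (\<lambda>i. 2 / 3 * (1 / 3) ^ i :: real)"
    by (intro summable_mult summable_geometric) auto
  show "norm (2 * of_bool (c i) / 3 ^ Suc i :: real) \<le> 2 / 3 * (1 / 3) ^ i" for i
    by (auto simp: power_divide field_simps)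
qed

lemma ternary_rec: "ternary c = (2 * of_bool (c 0) + ternary (\<lambda>i. c (Suc i))) / 3"
proof -
  have "ternary c = 2 * of_bool (c 0) / 3 + (\<Sum>i. 2 * of_bool (c (Suc i)) / 3 ^ Suc (Suc i))"
    using suminf_split_head[OF summable_ternary, of c] by (simp add: ternary_def)
  also have "(\<Sum>i. 2 * of_bool (c (Suc i)) / 3 ^ Suc (Suc i) :: real)
      = (\<Sum>i. 2 * of_bool (c (Suc i)) / 3 ^ Suc i) / 3"
    by (subst suminf_divide[OF summable_ternary, symmetric]) simp
  finally show ?thesis by (simp add: ternary_def)
qed

lemma abs_ternary_diff_rec:
  assumes "c 0 = c' 0"
  shows "\<bar>ternary c - ternary c'\<bar>
    = \<bar>ternary (\<lambda>i. c (Suc i)) - ternary (\<lambda>i. c' (Suc i))\<bar> / 3"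
  using assms by (simp add: ternary_rec[of c] ternary_rec[of c'] flip: diff_divide_distrib)

lemma ternary_bounds: "0 \<le> ternary c" "ternary c \<le> 1"
proof -
  show "0 \<le> ternary c"
    unfolding ternary_def by (intro suminf_nonneg summable_ternary) auto
  have "ternary c \<le> (\<Sum>i. 2 / 3 * (1 / 3) ^ i :: real)"
    unfolding ternary_def
  proof (intro suminf_le summable_ternary)
    show "summable (\<lambda>i. 2 / 3 * (1 / 3) ^ i :: real)"
      by (intro summable_mult summable_geometric) auto
  qed (auto simp: power_divide field_simps)
  also have "\<dots> = 1"
    by (subst suminf_mult) (auto simp: suminf_geometric)
  finally show "ternary c \<le> 1" .
qed

lemma ternary_in_cantor_stage: "ternary c \<in> cantor_stage n"
proof (induction n arbitrary: c)
  case 0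
  then show ?case using ternary_bounds by auto
next
  case (Suc n)
  have "ternary (\<lambda>i. c (Suc i)) \<in> cantor_stage n" by (rule Suc)
  then show ?case
    by (cases "c 0") (auto simp: ternary_rec[of c] add_divide_distrib)
qed

lemma cantor_stage_subset: "cantor_stage n \<subseteq> {0..1}"
  by (induction n) auto

lemma abs_ternary_diff_le:
  assumes "\<forall>i<n. c i = c' i"
  shows "\<bar>ternary c - ternary c'\<bar> \<le> 1 / 3 ^ n"
  using assms
proof (induction n arbitrary: c c')
  case 0
  then show ?case using ternary_bounds[of c] ternary_bounds[of c'] by auto
next
  case (Suc n)
  have "\<bar>ternary (\<lambda>i. c (Suc i)) - ternary (\<lambda>i. c' (Suc i))\<bar> \<le> 1 / 3 ^ n"
    using Suc.prems by (intro Suc.IH) auto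
  moreover have "c 0 = c' 0" using Suc.prems by auto
  ultimately show ?case
    by (simp add: abs_ternary_diff_rec field_simps)
qed

text \<open>At the first index \<open>i\<close> where the sequences differ, the digits contribute
  \<open>2 / 3 ^ Suc i\<close>, and the tails can cancel at most half of this. Any other index of
  disagreement is larger and gives a weaker bound.\<close>

lemma abs_ternary_diff_ge:
  assumes "c n \<noteq> c' n"
  shows "1 / 3 ^ Suc n \<le> \<bar>ternary c - ternary c'\<bar>"
proof -
  have *: "1 / 3 ^ Suc n \<le> \<bar>ternary c - ternary c'\<bar>"
    if "\<forall>i<n. c i = c' i" "c n \<noteq> c' n" for n c c'
    using that
  proof (induction n arbitrary: c c')
    case 0
    then show ?case
      using ternary_bounds[of "\<lambda>i. c (Suc i)"] ternary_bounds[of "\<lambda>i. c' (Suc i)"]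
      by (auto simp: ternary_rec[of c] ternary_rec[of c'] field_simps of_bool_def)
  next
    case (Suc n)
    have "1 / 3 ^ Suc n \<le> \<bar>ternary (\<lambda>i. c (Suc i)) - ternary (\<lambda>i. c' (Suc i))\<bar>"
      using Suc.prems by (intro Suc.IH) auto
    moreover have "c 0 = c' 0" using Suc.prems by auto
    ultimately show ?case
      by (simp add: abs_ternary_diff_rec field_simps)
  qed
  have "1 / 3 ^ Suc n \<le> (1 / 3 ^ Suc (first_diff c c') :: real)"
    using first_diff_le[of c n c'] assms by (intro divide_left_mono power_increasing) auto
  also have "\<dots> \<le> \<bar>ternary c - ternary c'\<bar>"
    using first_diff_neq[of c n c'] eq_before_first_diff assms by (intro *) blast+
  finally show ?thesis .
qed

lemma inj_ternary: "inj ternary"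
proof (rule injI, rule ccontr)
  fix c c' assume eq: "ternary c = ternary c'" and "c \<noteq> c'"
  then obtain n where "c n \<noteq> c' n" by auto
  from abs_ternary_diff_ge[of c n c', OF this] eq show False by (metis abs_zero diff_self divide_pos_pos not_le zero_less_numeral zero_less_one zero_less_power)
qed

text \<open>The expanding map of which \<open>cantor_set\<close> is the invariant set; on ternary
  expansions it drops the first digit. The threshold \<open>1 / 2\<close> may be any point of the
  removed middle third.\<close>

definition tripling :: "real \<Rightarrow> real" where
  "tripling x = 3 * x - 2 * of_bool (x > 1 / 2)"

lemma tripling_in_cantor_set:
  assumes "x \<in> cantor_set"
  shows "tripling x \<in> cantor_set"
proof -
  have "tripling x \<in> cantor_stage n" for n
  proof -
    have "x \<in> cantor_stage (Suc n)" using assms unfolding cantor_set_def by blast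
    then consider y where "y \<in> cantor_stage n" "x = y / 3"
      | y where "y \<in> cantor_stage n" "x = 2 / 3 + y / 3" by auto
    then show ?thesis
    proof cases
      case 1
      with cantor_stage_subset[of n] have "y \<le> 1" by auto
      with 1 have "tripling x = y" by (simp add: tripling_def)
      with 1 show ?thesis by simp
    next
      case 2
      with cantor_stage_subset[of n] have "y \<ge> 0" by auto
      with 2 show ?thesis by (simp add: tripling_def)
    qed
  qed
  then show ?thesis by (auto simp: cantor_set_def)
qed

text \<open>Surjectivity reads the digits of \<open>x\<close> off its orbit under
  \<open>tripling\<close>. The gap between a point and the value of its digits is a third of the
  same gap one step along the orbit. All these gaps are at most 1, so they vanish.\<close>

lemma cantor_set_eq_range_ternary: "cantor_set = range ternary"
proof
  show "range ternary \<subseteq> cantor_set"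
    using ternary_in_cantor_stage by (auto simp: cantor_set_def)
  show "cantor_set \<subseteq> range ternary"
  proof
    fix x assume x: "x \<in> cantor_set"
    define digits where "digits x i \<longleftrightarrow> (tripling ^^ i) x > 1 / 2" for x i
    have shift: "(\<lambda>i. digits x (Suc i)) = digits (tripling x)" for x
      by (auto simp: digits_def funpow_swap1)
    have digits_0: "digits x 0 \<longleftrightarrow> x > 1 / 2" for x by (simp add: digits_def)
    have approx: "\<bar>x - ternary (digits x)\<bar> \<le> 1 / 3 ^ n" if "x \<in> cantor_set" for x n
      using that
    proof (induction n arbitrary: x)
      case 0
      then have "x \<in> cantor_stage 0" unfolding cantor_set_def by blast
      then show ?case using ternary_bounds[of "digits x"] by auto
    next
      case (Suc n)
      have "x - ternary (digits x) = (tripling x - ternary (digits (tripling x))) / 3"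
        by (simp add: ternary_rec[of "digits x"] shift tripling_def digits_0 field_simps)
      then have "\<bar>x - ternary (digits x)\<bar> = \<bar>tripling x - ternary (digits (tripling x))\<bar> / 3"
        by (simp only: abs_divide abs_numeral)
      also have "\<dots> \<le> 1 / 3 ^ n / 3"
        by (intro divide_right_mono Suc.IH tripling_in_cantor_set Suc.prems) auto
      finally show ?case by simp
    qed
    have "(\<lambda>n. (1 / 3) ^ n :: real) \<longlonglongrightarrow> 0" by (rule LIMSEQ_realpow_zero) auto
    then have "\<bar>x - ternary (digits x)\<bar> \<le> 0"
      by (rule Lim_bounded2) (use approx[OF x] in \<open>simp add: power_divide\<close>)
    then show "x \<in> range ternary" by auto
  qed
qed

section \<open>Cylinders and the coin-tossing measure\<close>

lemma ennreal_eq_0I: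
  fixes x :: ennreal
  assumes "\<And>e. e > 0 \<Longrightarrow> x \<le> ennreal e"
  shows "x = 0"
proof -
  have "x \<le> 0" by (rule ennreal_le_epsilon) (simp add: assms)
  then show ?thesis by simp
qed

definition cylinder :: "(nat \<Rightarrow> bool) \<Rightarrow> nat \<Rightarrow> (nat \<Rightarrow> bool) set" where
  "cylinder c k = {c'. \<forall>i<k. c i = c' i}"

definition coin_measure :: "(nat \<Rightarrow> bool) measure" where
  "coin_measure = (\<Pi>\<^sub>M i\<in>UNIV. measure_pmf (pmf_of_set UNIV))"

lemma space_coin_measure: "space coin_measure = UNIV"
  by (simp add: coin_measure_def space_PiM)

lemma cylinder_eq_prod_emb:
  "cylinder c k = prod_emb UNIV (\<lambda>_. measure_pmf (pmf_of_set UNIV)) {..<k} (\<Pi>\<^sub>E i\<in>{..<k}. {c i})"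
  by (rule set_eqI) (simp add: cylinder_def prod_emb_def Pi_iff Ball_def, metis)

lemma cylinder_in_sets: "cylinder c k \<in> sets coin_measure"
  unfolding coin_measure_def cylinder_eq_prod_emb by (rule sets_PiM_I) auto

lemma emeasure_cylinder: "emeasure coin_measure (cylinder c k) = ennreal (2 powr - real k)"
proof -
  have "emeasure coin_measure (cylinder c k)
      = (\<Prod>i<k. emeasure (measure_pmf (pmf_of_set UNIV)) {c i})"
    unfolding coin_measure_def cylinder_eq_prod_emb
    by (rule emeasure_PiM_emb) (auto simp: prob_space_measure_pmf)
  also have "\<dots> = (\<Prod>i<k. ennreal (1 / 2))"
    by (intro prod.cong refl) (simp add: emeasure_pmf_single)
  also have "\<dots> = ennreal ((1 / 2) ^ k)"
    by (simp only: prod_constant card_lessThan ennreal_power)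
  also have "(1 / 2) ^ k = 2 powr - real k"
    by (simp only: powr_minus_divide powr_realpow power_one_over zero_less_numeral)
  finally show ?thesis .
qed

lemma singleton_eq_INT_cylinder: "{c} = (\<Inter>k. cylinder c k)"
  by (auto simp: cylinder_def)

lemma singleton_in_sets: "{c} \<in> sets coin_measure"
  unfolding singleton_eq_INT_cylinder by (intro sets.countable_INT) (auto simp: cylinder_in_sets)

text \<open>Needed for members of a cover that have diameter 0: their weight is 0 for positive
  \<open>s\<close>, so their mass has to be 0 too.\<close>

lemma emeasure_coin_singleton: "emeasure coin_measure {c} = 0"
proof -
  have "emeasure coin_measure {c} \<le> ennreal e" if "e > 0" for e
  proof -
    have "(\<lambda>k. 2 powr - real k) \<longlonglongrightarrow> 0" by real_asymp
    then have "\<forall>\<^sub>F k in sequentially. 2 powr - real k < e" using that by (rule order_tendstoD)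
    then obtain k where "2 powr - real k < e" by (auto simp: eventually_sequentially)
    then have "ennreal (2 powr - real k) \<le> ennreal e" by (simp add: ennreal_leI)
    moreover have "emeasure coin_measure {c} \<le> emeasure coin_measure (cylinder c k)"
      by (rule emeasure_mono[OF _ cylinder_in_sets]) (auto simp: cylinder_def)
    ultimately show ?thesis by (simp add: emeasure_cylinder)
  qed
  then show ?thesis by (rule ennreal_eq_0I)
qed

lemma emeasure_coin_UNIV: "emeasure coin_measure UNIV = 1"
proof -
  have "cylinder c 0 = UNIV" for c by (auto simp: cylinder_def)
  then show ?thesis using emeasure_cylinder[of _ 0] by simp
qed

section \<open>Ultrametrics on the Cantor set\<close>

locale cantor_ultrametric =
  fixes p :: "nat \<Rightarrow> real"
  assumes strict_mono_p: "strict_mono p"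
    and p_at_top: "filterlim p at_top sequentially"
begin

text \<open>The values \<open>radius k\<close> are exactly the nonzero distances, and
  \<open>radius k\<close> is the diameter of every cylinder of length \<open>k\<close>.\<close>

definition radius :: "nat \<Rightarrow> real" where
  "radius k = 2 powr - p k"

definition cdist :: "(nat \<Rightarrow> bool) \<Rightarrow> (nat \<Rightarrow> bool) \<Rightarrow> real" where
  "cdist c c' = (if c = c' then 0 else radius (first_diff c c'))"

text \<open>The metric on sequences is carried over to the Cantor set itself, so that the required
  homeomorphism can be the identity.\<close>

definition cmetric :: "real metric" where
  "cmetric = metric (cantor_set, \<lambda>x y. cdist (inv ternary x) (inv ternary y))"

lemma radius_pos: "radius k > 0"
  by (simp add: radius_def)

lemma radius_less_iff [simp]: "radius j < radius k \<longleftrightarrow> k < j"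
  using strict_mono_less[OF strict_mono_p] by (simp add: radius_def)

lemma radius_le_iff [simp]: "radius j \<le> radius k \<longleftrightarrow> k \<le> j"
  using strict_mono_less_eq[OF strict_mono_p] by (simp add: radius_def)

lemma radius_tendsto_0: "radius \<longlonglongrightarrow> 0"
proof -
  have "((\<lambda>x::real. 2 powr - x) \<longlongrightarrow> 0) at_top" by real_asymp
  from filterlim_compose[OF this p_at_top] show ?thesis by (simp add: radius_def[abs_def])
qed

lemma ex_radius_less:
  assumes "t > 0"
  obtains k where "radius k < t"
  using order_tendstoD(2)[OF radius_tendsto_0 assms] that by (auto simp: eventually_sequentially)

lemma cdist_nonneg: "0 \<le> cdist c c'"
  using radius_pos by (simp add: cdist_def less_imp_le)

text \<open>Since \<open>radius\<close> is strictly decreasing, comparing distances amounts to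
  comparing indices of first difference. Through this equivalence balls become cylinders in all
  later arguments.\<close>

lemma cdist_le_radius_iff: "cdist c c' \<le> radius k \<longleftrightarrow> c' \<in> cylinder c k"
proof (cases "c = c'")
  case False
  then obtain i where i: "c i \<noteq> c' i" by auto
  from False have "cdist c c' \<le> radius k \<longleftrightarrow> k \<le> first_diff c c'" by (simp add: cdist_def)
  also have "\<dots> \<longleftrightarrow> c' \<in> cylinder c k"
  proof
    show "c' \<in> cylinder c k" if "k \<le> first_diff c c'"
      using that eq_before_first_diff by (auto simp: cylinder_def)
    show "k \<le> first_diff c c'" if "c' \<in> cylinder c k"
      using that first_diff_neq[of c i c', OF i] by (force simp: cylinder_def intro: leI)
  qed
  finally show ?thesis .
qed (use radius_pos in \<open>auto simp: cdist_def cylinder_def less_imp_le\<close>)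

text \<open>At the index where \<open>c\<close> and \<open>c''\<close> first differ,
  \<open>c'\<close> differs from one of the two, hence first differs from it no later.\<close>

lemma cdist_ultra: "cdist c c'' \<le> max (cdist c c') (cdist c' c'')"
proof (cases "c = c''")
  case False
  define i where "i = first_diff c c''"
  obtain j where "c j \<noteq> c'' j" using False by auto
  then have "c i \<noteq> c'' i" unfolding i_def by (rule first_diff_neq[of c j c''])
  then have "c i \<noteq> c' i \<or> c' i \<noteq> c'' i" by auto
  then have "radius i \<le> cdist c c' \<or> radius i \<le> cdist c' c''"
    using first_diff_le[of c i c'] first_diff_le[of c' i c''] by (auto simp: cdist_def)
  moreover have "cdist c c'' = radius i" using False by (simp add: cdist_def i_def)
  ultimately show ?thesis by (simp only: le_max_iff_disj)
qed (use cdist_nonneg in \<open>simp add: cdist_def[of c'' c''] le_max_iff_disj\<close>)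

lemma Metric_space_cdist:
  "Metric_space cantor_set (\<lambda>x y. cdist (inv ternary x) (inv ternary y))"
proof
  fix x y z assume xy: "x \<in> cantor_set" "y \<in> cantor_set"
  then show "cdist (inv ternary x) (inv ternary y) = 0 \<longleftrightarrow> x = y"
    using radius_pos[of "first_diff (inv ternary x) (inv ternary y)"]
    by (auto simp: cdist_def cantor_set_eq_range_ternary inj_ternary)
  show "cdist (inv ternary x) (inv ternary z)
      \<le> cdist (inv ternary x) (inv ternary y) + cdist (inv ternary y) (inv ternary z)"
    using cdist_ultra[of "inv ternary x" "inv ternary z" "inv ternary y"] cdist_nonneg
    by (smt (verit, best))
next
  show "cdist (inv ternary x) (inv ternary y) = cdist (inv ternary y) (inv ternary x)" for x y
    by (simp add: cdist_def first_diff_commute[of "inv ternary x"] eq_commute[of "inv ternary x"])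
qed (rule cdist_nonneg)

lemma mspace_cmetric: "mspace cmetric = range ternary"
  unfolding cmetric_def Metric_space.mspace_metric[OF Metric_space_cdist]
  by (rule cantor_set_eq_range_ternary)

lemma mdist_cmetric: "mdist cmetric (ternary c) (ternary c') = cdist c c'"
  unfolding cmetric_def Metric_space.mdist_metric[OF Metric_space_cdist] by (simp add: inj_ternary)

section \<open>Comparison with the Euclidean topology\<close>

lemma cylinderI_ternary:
  assumes "\<bar>ternary c - ternary c'\<bar> < 1 / 3 ^ k"
  shows "c' \<in> cylinder c k"
proof -
  have False if "i < k" "c i \<noteq> c' i" for i
  proof -
    have "1 / 3 ^ k \<le> (1 / 3 ^ Suc i :: real)"
      using that(1) by (intro divide_left_mono power_increasing) auto
    also have "\<dots> \<le> \<bar>ternary c - ternary c'\<bar>" by (rule abs_ternary_diff_ge[of c i c', OF that(2)])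
    finally show False using assms by simp
  qed
  then show ?thesis by (auto simp: cylinder_def)
qed

text \<open>In both topologies the cylinders around a point form a neighbourhood base: a cylinder of
  length \<open>k\<close> contains all points at Euclidean distance less than
  \<open>1 / 3 ^ k\<close> and lies within Euclidean distance \<open>1 / 3 ^ k\<close>.\<close>

lemma mtopology_cmetric: "mtopology_of cmetric = top_of_set cantor_set"
proof (rule topology_eq[THEN iffD2], intro allI iffI)
  interpret M: Metric_space cantor_set "\<lambda>x y. cdist (inv ternary x) (inv ternary y)"
    by (rule Metric_space_cdist)
  fix U
  have ball: "M.mball (ternary c) r \<subseteq> U \<longleftrightarrow> (\<forall>c'. cdist c c' < r \<longrightarrow> ternary c' \<in> U)" for c r
    unfolding M.mball_def by (auto simp: cantor_set_eq_range_ternary inj_ternary)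
  have opn: "openin (mtopology_of cmetric) U \<longleftrightarrow> U \<subseteq> range ternary \<and>
      (\<forall>c. ternary c \<in> U \<longrightarrow> (\<exists>r>0. \<forall>c'. cdist c c' < r \<longrightarrow> ternary c' \<in> U))"
  proof -
    have "openin (mtopology_of cmetric) U \<longleftrightarrow>
        U \<subseteq> range ternary \<and> (\<forall>x. x \<in> U \<longrightarrow> (\<exists>r>0. M.mball x r \<subseteq> U))"
      unfolding cmetric_def M.mtopology_of M.openin_mtopology
      by (simp only: cantor_set_eq_range_ternary)
    also have "\<dots> \<longleftrightarrow> U \<subseteq> range ternary \<and>
        (\<forall>c. ternary c \<in> U \<longrightarrow> (\<exists>r>0. M.mball (ternary c) r \<subseteq> U))"
      by blast
    finally show ?thesis unfolding ball .
  qed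
  have opn': "openin (top_of_set cantor_set) U \<longleftrightarrow> U \<subseteq> range ternary \<and>
      (\<forall>c. ternary c \<in> U \<longrightarrow> (\<exists>e>0. \<forall>c'. \<bar>ternary c - ternary c'\<bar> < e \<longrightarrow> ternary c' \<in> U))"
    unfolding openin_euclidean_subtopology_iff cantor_set_eq_range_ternary
    by (simp add: dist_real_def abs_minus_commute subset_iff ball_simps) blast
  show "openin (top_of_set cantor_set) U" if "openin (mtopology_of cmetric) U"
    unfolding opn'
  proof (intro conjI allI impI)
    show "U \<subseteq> range ternary" using that opn by blast
    fix c assume "ternary c \<in> U"
    with that opn obtain r where r: "r > 0" "\<And>c'. cdist c c' < r \<Longrightarrow> ternary c' \<in> U" by blast
    obtain k where "radius k < r" using r(1) by (rule ex_radius_less)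
    then have "ternary c' \<in> U" if "\<bar>ternary c - ternary c'\<bar> < 1 / 3 ^ k" for c'
      using cylinderI_ternary[OF that] r(2)[of c'] by (simp flip: cdist_le_radius_iff)
    then show "\<exists>e>0. \<forall>c'. \<bar>ternary c - ternary c'\<bar> < e \<longrightarrow> ternary c' \<in> U"
      by (intro exI[of _ "1 / 3 ^ k"]) auto
  qed
  show "openin (mtopology_of cmetric) U" if "openin (top_of_set cantor_set) U"
    unfolding opn
  proof (intro conjI allI impI)
    show "U \<subseteq> range ternary" using that opn' by blast
    fix c assume "ternary c \<in> U"
    with that opn' obtain e
      where e: "e > 0" "\<And>c'. \<bar>ternary c - ternary c'\<bar> < e \<Longrightarrow> ternary c' \<in> U" by blast
    obtain k where k: "(1 / 3) ^ k < e" using real_arch_pow_inv[OF e(1)] by force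
    have "ternary c' \<in> U" if "cdist c c' < radius k" for c'
    proof -
      have "c' \<in> cylinder c k" using that by (simp flip: cdist_le_radius_iff)
      then have "\<bar>ternary c - ternary c'\<bar> \<le> 1 / 3 ^ k"
        by (intro abs_ternary_diff_le) (auto simp: cylinder_def)
      also have "\<dots> < e" using k by (simp add: power_divide)
      finally show ?thesis by (rule e(2))
    qed
    then show "\<exists>r>0. \<forall>c'. cdist c c' < r \<longrightarrow> ternary c' \<in> U"
      using radius_pos by blast
  qed
qed

lemma cantor_metric_space_cmetric: "cantor_metric_space cmetric"
  unfolding cantor_metric_space_def mtopology_cmetric by (rule homeomorphic_space_refl)

section \<open>Upper bound for the Hausdorff dimension\<close>

lemma mdiam_cylinder_le: "mdiam cmetric (ternary ` cylinder c k) \<le> ennreal (radius k)"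
  unfolding mdiam_def
  by (intro SUP_least)
     (auto simp: mdist_cmetric cdist_le_radius_iff cylinder_def intro!: ennreal_leI)

lemma hausdorff_weight_cylinder_le:
  assumes "s > 0"
  shows "hausdorff_weight cmetric s (ternary ` cylinder c k) \<le> ennreal (2 powr - (s * p k))"
proof -
  have "enn2real (mdiam cmetric (ternary ` cylinder c k)) \<le> radius k"
    using mdiam_cylinder_le radius_pos by (intro enn2real_leI) (auto simp: less_imp_le)
  then have "enn2real (mdiam cmetric (ternary ` cylinder c k)) powr s \<le> radius k powr s"
    using assms by (intro powr_mono2) auto
  also have "\<dots> = 2 powr - (s * p k)" by (simp add: radius_def powr_powr mult.commute)
  finally show ?thesis using assms by (auto simp: hausdorff_weight_def intro: ennreal_leI)
qed

text \<open>The cover consists of the \<open>2 ^ k\<close> cylinders of length \<open>k\<close>,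
  each of weight at most \<open>2 powr - (s * p k)\<close>.\<close>

lemma hausdorff_premeasure_le:
  assumes "s > 0" "radius k \<le> \<delta>"
  shows "hausdorff_premeasure cmetric s \<delta> (mspace cmetric) \<le> ennreal (2 powr (k - s * p k))"
proof -
  \<comment> \<open>A prefix of length \<open>k\<close> is encoded as the set of indices where it is
    true. Empty sets, of weight 0, fill up the rest of the infinite sequence.\<close>
  obtain e where e: "bij_betw e {0..<(2::nat) ^ k} (Pow {..<k})"
    using ex_bij_betw_nat_finite[of "Pow {..<k}"] that by (auto simp: card_Pow)
  define U where
    "U n = (if n < 2 ^ k then ternary ` cylinder (\<lambda>i. i \<in> e n) k else {})" for n :: nat
  have "hausdorff_premeasure cmetric s \<delta> (mspace cmetric) \<le> (\<Sum>n. hausdorff_weight cmetric s (U n))"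
    unfolding hausdorff_premeasure_def
  proof (rule Inf_lower, intro CollectI exI[of _ U] conjI refl allI)
    show "U n \<subseteq> mspace cmetric" for n by (auto simp: U_def mspace_cmetric)
    have "mdiam cmetric (ternary ` cylinder c k) \<le> ennreal \<delta>" for c
      using mdiam_cylinder_le assms(2) by (meson ennreal_leI order_trans)
    then show "mdiam cmetric (U n) \<le> ennreal \<delta>" for n by (simp add: U_def mdiam_def bot_ennreal)
    have "ternary c \<in> (\<Union>n. U n)" for c
    proof -
      have "{i. i < k \<and> c i} \<in> e ` {0..<2 ^ k}"
        using bij_betw_imp_surj_on[OF e] by auto
      then obtain n where n: "n < 2 ^ k" "e n = {i. i < k \<and> c i}" by auto
      then have "c \<in> cylinder (\<lambda>i. i \<in> e n) k" by (simp add: cylinder_def)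
      with n show ?thesis by (auto simp: U_def)
    qed
    then show "mspace cmetric \<subseteq> (\<Union>n. U n)" by (auto simp: mspace_cmetric)
  qed
  also have "\<dots> = (\<Sum>n<2 ^ k. hausdorff_weight cmetric s (U n))"
    by (rule suminf_finite) (auto simp: U_def hausdorff_weight_def)
  also have "\<dots> \<le> (\<Sum>n<(2::nat) ^ k. ennreal (2 powr - (s * p k)))"
    by (intro sum_mono) (use assms in \<open>simp add: U_def hausdorff_weight_cylinder_le\<close>)
  also have "\<dots> = ennreal (2 powr (k - s * p k))"
    by (simp add: powr_diff powr_minus divide_inverse powr_realpow ennreal_mult ennreal_power
        flip: ennreal_numeral)
  finally show ?thesis .
qed

text \<open>At \<open>s\<close> itself the hypothesis only bounds the cost of the covers by 1. For
  \<open>s' > s\<close> the cost at the favourable \<open>k\<close> is at most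
  \<open>2 powr - ((s' - s) * p k)\<close>, which tends to 0.\<close>

lemma hausdorff_dim_le:
  assumes "s > 0" "\<And>m. \<exists>k\<ge>m. real k \<le> s * p k"
  shows "hausdorff_dim cmetric \<le> ennreal s"
proof (rule dense_ge)
  fix y assume y: "ennreal s < y"
  show "hausdorff_dim cmetric \<le> y"
  proof (cases y)
    case (real s')
    with y assms(1) have s': "s < s'" "0 < s'" by (auto simp: ennreal_less_iff)
    have "hausdorff_premeasure cmetric s' \<delta> (mspace cmetric) \<le> ennreal e" if "\<delta> > 0" "e > 0" for \<delta> e
    proof -
      define d where "d = s' - s"
      have "d > 0" using s' by (simp add: d_def)
      then have "((\<lambda>x. 2 powr - (d * x)) \<longlongrightarrow> 0) at_top" by real_asymp
      from filterlim_compose[OF this p_at_top]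
      have "\<forall>\<^sub>F k in sequentially. 2 powr - (d * p k) < e"
        using that(2) by (rule order_tendstoD)
      moreover have "\<forall>\<^sub>F k in sequentially. radius k < \<delta>"
        using radius_tendsto_0 that(1) by (rule order_tendstoD)
      ultimately have "\<forall>\<^sub>F k in sequentially. 2 powr - (d * p k) < e \<and> radius k < \<delta>"
        by eventually_elim simp
      then obtain m where m: "\<And>k. k \<ge> m \<Longrightarrow> 2 powr - (d * p k) < e \<and> radius k < \<delta>"
        by (auto simp: eventually_sequentially)
      obtain k where k: "k \<ge> m" "real k \<le> s * p k" using assms(2) by blast
      have "hausdorff_premeasure cmetric s' \<delta> (mspace cmetric) \<le> ennreal (2 powr (k - s' * p k))"
        using s' m k(1) by (intro hausdorff_premeasure_le) (auto intro: less_imp_le)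
      also have "2 powr (k - s' * p k) \<le> 2 powr - (d * p k)"
        using k(2) by (simp add: d_def algebra_simps)
      also have "\<dots> \<le> e" using m k(1) by (simp add: less_imp_le)
      finally show ?thesis by (simp add: ennreal_leI)
    qed
    then have "hausdorff_premeasure cmetric s' \<delta> (mspace cmetric) = 0" if "\<delta> > 0" for \<delta>
      using that by (intro ennreal_eq_0I)
    then have "hausdorff_measure cmetric s' (mspace cmetric) = 0"
      unfolding hausdorff_measure_def by (auto simp: SUP_eq_iff intro!: antisym SUP_least)
    then show ?thesis
      unfolding hausdorff_dim_def real using s' by (intro Inf_lower) auto
  qed simp
qed

section \<open>Lower bound for the Hausdorff dimension by mass distribution\<close>

lemma cdist_le_mdiam:
  assumes "ternary c \<in> U" "ternary c' \<in> U" "mdiam cmetric U < \<infinity>"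
  shows "cdist c c' \<le> enn2real (mdiam cmetric U)"
proof -
  have "ennreal (cdist c c') \<le> mdiam cmetric U"
    unfolding mdiam_def using assms(1,2)
    by (intro SUP_upper2[of "ternary c"] SUP_upper2[of "ternary c'"]) (auto simp: mdist_cmetric)
  also have "\<dots> = ennreal (enn2real (mdiam cmetric U))" using assms(3) by simp
  finally show ?thesis by (simp add: ennreal_le_iff)
qed

text \<open>For \<open>t > 0\<close> this is the length of the cylinders that are the closed balls
  of radius \<open>t\<close>, also when \<open>t\<close> is not one of the values
  \<open>radius k\<close>.\<close>

definition level :: "real \<Rightarrow> nat" where
  "level t = (LEAST k. radius k \<le> t)"

lemma radius_le_iff_level_le:
  assumes "t > 0"
  shows "radius j \<le> t \<longleftrightarrow> level t \<le> j"
proof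
  obtain k where "radius k < t" using assms by (rule ex_radius_less)
  then have level: "radius (level t) \<le> t"
    unfolding level_def by (intro LeastI[of "\<lambda>k. radius k \<le> t" k]) simp
  show "level t \<le> j" if "radius j \<le> t" unfolding level_def using that by (rule Least_le)
  show "radius j \<le> t" if "level t \<le> j"
    using order_trans[OF _ level, of "radius j"] that by simp
qed

lemma cdist_le_iff:
  assumes "t > 0"
  shows "cdist c c' \<le> t \<longleftrightarrow> c' \<in> cylinder c (level t)"
  unfolding cdist_le_radius_iff[symmetric] cdist_def
  using assms radius_pos[of "level t"] radius_le_iff_level_le[OF assms, of "first_diff c c'"]
  by auto

text \<open>A set of diameter \<open>D > 0\<close> lies in a ball of radius \<open>D\<close>, that
  is, in a cylinder of length \<open>k = level D\<close>. The growth bound on \<open>p\<close>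
  compares its mass \<open>2 powr - real k\<close> with \<open>D powr s\<close>. The measurable
  superset \<open>S\<close> is there because members of a cover may be arbitrary sets.\<close>

lemma emeasure_coin_le_hausdorff_weight:
  assumes "0 \<le> s" "0 \<le> C" "\<And>k. s * p k \<le> real k + C" "U \<subseteq> mspace cmetric"
    and fin: "mdiam cmetric U < \<infinity>"
  obtains S where "S \<in> sets coin_measure" "ternary -` U \<subseteq> S"
    "emeasure coin_measure S \<le> ennreal (2 powr C) * hausdorff_weight cmetric s U"
proof -
  define D where "D = enn2real (mdiam cmetric U)"
  consider "U = {}" | "U \<noteq> {}" "s = 0" | c where "ternary c \<in> U" "s > 0"
    using assms(1,4) unfolding mspace_cmetric by force
  then show ?thesis
  proof cases
    case 1
    then show ?thesis by (intro that[of "{}"]) auto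
  next
    \<comment> \<open>For \<open>s = 0\<close> every nonempty set has weight 1, which already
      dominates the total mass.\<close>
    case 2
    have "1 \<le> ennreal (2 powr C)"
      using assms(2) by (simp add: ge_one_powr_ge_zero flip: ennreal_1)
    with 2 show ?thesis
      using sets.top[of coin_measure]
      by (intro that[of UNIV]) (auto simp: hausdorff_weight_def emeasure_coin_UNIV space_coin_measure)
  next
    case 3
    have dist: "cdist c c' \<le> D" if "ternary c' \<in> U" for c'
      unfolding D_def using 3(1) that fin by (rule cdist_le_mdiam)
    show ?thesis
    proof (cases "D = 0")
      case True
      have "c' = c" if "ternary c' \<in> U" for c'
        using dist[OF that] True radius_pos[of "first_diff c c'"]
        by (auto simp: cdist_def split: if_splits)
      then show ?thesis
        by (intro that[of "{c}"]) (auto simp: singleton_in_sets emeasure_coin_singleton)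
    next
      case False
      then have D: "D > 0"
        using enn2real_nonneg[of "mdiam cmetric U"] unfolding D_def by linarith
      define k where "k = level D"
      have "2 powr - real k \<le> 2 powr (C + - (s * p k))" using assms(3)[of k] by simp
      also have "\<dots> = 2 powr C * radius k powr s"
        unfolding powr_add by (simp add: radius_def powr_powr mult.commute)
      also have "\<dots> \<le> 2 powr C * D powr s"
        using radius_le_iff_level_le[OF D, of k] radius_pos[of k] assms(1)
        by (intro mult_left_mono powr_mono2) (auto simp: k_def)
      finally have "ennreal (2 powr - real k) \<le> ennreal (2 powr C) * hausdorff_weight cmetric s U"
        using 3 by (auto simp: hausdorff_weight_def D_def ennreal_leI simp flip: ennreal_mult)
      then show ?thesis
        using dist cdist_le_iff[OF D]
        by (intro that[of "cylinder c k"]) (auto simp: k_def cylinder_in_sets emeasure_cylinder)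
    qed
  qed
qed

text \<open>Mass distribution principle: the masses of the supersets of a cover sum to at least 1,
  and they are at most \<open>2 powr C\<close> times the weights. So every cover costs at least
  \<open>2 powr - C\<close>. As the measure is a supremum over scales, the single scale 1 suffices;
  it makes all diameters finite.\<close>

lemma hausdorff_measure_nonzero:
  assumes "0 \<le> s" "0 \<le> C" "\<And>k. s * p k \<le> real k + C"
  shows "hausdorff_measure cmetric s (mspace cmetric) \<noteq> 0"
proof -
  have "ennreal (2 powr - C) \<le> hausdorff_premeasure cmetric s 1 (mspace cmetric)"
    unfolding hausdorff_premeasure_def
  proof (rule Inf_greatest, clarify)
    fix U :: "nat \<Rightarrow> real set"
    assume U: "\<forall>n. U n \<subseteq> mspace cmetric \<and> mdiam cmetric (U n) \<le> ennreal 1"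
      and cov: "mspace cmetric \<subseteq> (\<Union>n. U n)"
    have "\<exists>S. S \<in> sets coin_measure \<and> ternary -` U n \<subseteq> S \<and>
        emeasure coin_measure S \<le> ennreal (2 powr C) * hausdorff_weight cmetric s (U n)" for n
    proof -
      have "mdiam cmetric (U n) \<le> ennreal 1" using U by blast
      also have "\<dots> < \<infinity>" by simp
      finally have "U n \<subseteq> mspace cmetric" "mdiam cmetric (U n) < \<infinity>" using U by auto
      then show ?thesis
        by (rule emeasure_coin_le_hausdorff_weight[OF assms]) blast
    qed
    then have "\<exists>S. \<forall>n. S n \<in> sets coin_measure \<and> ternary -` U n \<subseteq> S n \<and>
        emeasure coin_measure (S n) \<le> ennreal (2 powr C) * hausdorff_weight cmetric s (U n)"
      by (intro choice allI)
    then obtain S where S: "\<And>n. S n \<in> sets coin_measure" "\<And>n. ternary -` U n \<subseteq> S n"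
        "\<And>n. emeasure coin_measure (S n) \<le> ennreal (2 powr C) * hausdorff_weight cmetric s (U n)"
      by auto
    have "c \<in> (\<Union>n. S n)" for c
    proof -
      obtain n where "ternary c \<in> U n" using cov by (auto simp: mspace_cmetric)
      then show ?thesis using S(2)[of n] by auto
    qed
    then have "(\<Union>n. S n) = UNIV" by auto
    then have "1 = emeasure coin_measure (\<Union>n. S n)" by (simp add: emeasure_coin_UNIV)
    also have "\<dots> \<le> (\<Sum>n. emeasure coin_measure (S n))"
      using S(1) by (intro emeasure_subadditive_countably) auto
    also have "\<dots> \<le> (\<Sum>n. ennreal (2 powr C) * hausdorff_weight cmetric s (U n))"
      using S(3) by (intro suminf_le) auto
    also have "\<dots> = ennreal (2 powr C) * (\<Sum>n. hausdorff_weight cmetric s (U n))" by simp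
    finally have "ennreal (2 powr - C) * 1
        \<le> ennreal (2 powr - C) * (ennreal (2 powr C) * (\<Sum>n. hausdorff_weight cmetric s (U n)))"
      by (intro mult_left_mono) auto
    also have "\<dots> = (\<Sum>n. hausdorff_weight cmetric s (U n))"
      by (simp add: mult.assoc[symmetric] flip: ennreal_mult powr_add)
    finally show "ennreal (2 powr - C) \<le> (\<Sum>n. hausdorff_weight cmetric s (U n))" by simp
  qed
  also have "\<dots> \<le> hausdorff_measure cmetric s (mspace cmetric)"
    unfolding hausdorff_measure_def by (intro SUP_upper) auto
  finally show ?thesis by auto
qed

section \<open>Bounds for the Assouad dimension\<close>

lemma card_covering_centers_le:
  "card (ternary ` (\<lambda>A i. if i < k then c i else i \<in> A) ` Pow {k..<l}) \<le> 2 ^ (l - k)"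
proof -
  have "card (ternary ` (\<lambda>A i. if i < k then c i else i \<in> A) ` Pow {k..<l}) \<le> card (Pow {k..<l})"
    unfolding image_image by (rule card_image_le) simp
  then show ?thesis by (simp add: card_Pow)
qed

text \<open>A ball of radius \<open>r\<close> is a cylinder of length \<open>level r\<close>. It
  splits into cylinders of length \<open>level (\<epsilon> * r)\<close>, which are balls of radius
  \<open>\<epsilon> * r\<close>.\<close>

lemma covering_number_le:
  assumes "\<epsilon> > 0" and N: "\<And>r. r > 0 \<Longrightarrow> 2 ^ (level (\<epsilon> * r) - level r) \<le> N"
  shows "covering_number cmetric \<epsilon> \<le> enat N"
  unfolding covering_number_def
proof (rule Inf_lower, intro CollectI exI[of _ N] conjI refl ballI allI impI)
  fix x r :: real
  assume "x \<in> mspace cmetric" and r: "r > 0"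
  then obtain c where x: "x = ternary c" by (auto simp: mspace_cmetric)
  define k where "k = level r"
  define l where "l = level (\<epsilon> * r)"
  \<comment> \<open>One centre for each continuation of the prefix of \<open>c\<close> from length
    \<open>k\<close> to length \<open>l\<close>. If \<open>l \<le> k\<close>, only
    \<open>A = {}\<close> remains, in accordance with the truncated difference
    \<open>l - k = 0\<close>.\<close>
  define center where "center A i \<longleftrightarrow> (if i < k then c i else i \<in> A)" for A i
  define C where "C = ternary ` center ` Pow {k..<l}"
  have "card C \<le> 2 ^ (l - k)"
    using card_covering_centers_le[of k c l] by (simp add: C_def center_def[abs_def])
  also have "\<dots> \<le> N" using N[OF r] by (simp add: k_def l_def)
  finally have card: "card C \<le> N" .
  have "y \<in> (\<Union>z\<in>C. mcball_of cmetric z (\<epsilon> * r))" if mem: "y \<in> mcball_of cmetric x r" for y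
  proof -
    obtain c' where y: "y = ternary c'" "cdist c c' \<le> r"
      using mem by (auto simp: x mspace_cmetric mdist_cmetric)
    then have c': "c' \<in> cylinder c k" using cdist_le_iff[OF r] by (simp add: k_def)
    define A where "A = {i \<in> {k..<l}. c' i}"
    have "c' \<in> cylinder (center A) l"
      using c' by (auto simp: cylinder_def center_def A_def)
    then have "cdist (center A) c' \<le> \<epsilon> * r"
      using cdist_le_iff[of "\<epsilon> * r"] assms(1) r by (simp add: l_def)
    moreover have "ternary (center A) \<in> C" unfolding C_def by (intro imageI) (auto simp: A_def)
    ultimately show ?thesis by (force simp: y mspace_cmetric mdist_cmetric)
  qed
  then have "mcball_of cmetric x r \<subseteq> (\<Union>z\<in>C. mcball_of cmetric z (\<epsilon> * r))" by blast
  then show "\<exists>C\<subseteq>mspace cmetric. finite C \<and> card C \<le> N \<and>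
      mcball_of cmetric x r \<subseteq> (\<Union>z\<in>C. mcball_of cmetric z (\<epsilon> * r))"
    using card by (intro exI[of _ C]) (auto simp: C_def mspace_cmetric)
qed

lemma assouad_dim_le:
  assumes "0 < s" "0 \<le> C" "\<And>j n. real n \<le> s * (p (j + n) - p j) + C"
  shows "assouad_dim cmetric \<le> ennreal s"
proof -
  \<comment> \<open>One factor 2 pays for the level lost to rounding, \<open>2 powr C\<close> comes
    from the hypothesis, and \<open>2 powr s\<close> compensates for
    \<open>\<epsilon> powr - s\<close> dropping below 1, though never below
    \<open>2 powr - s\<close>, when \<open>\<epsilon>\<close> exceeds 1.\<close>
  define K where "K = 2 powr (1 + C + s)"
  have bound: "2 ^ (level (\<epsilon> * r) - level r) \<le> K * \<epsilon> powr - s"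
    if \<epsilon>: "0 < \<epsilon>" "\<epsilon> < 2" and r: "r > 0" for \<epsilon> r
  proof (cases "level (\<epsilon> * r) \<le> level r")
    case True
    have "1 \<le> 2 powr (1 + C)" using assms(2) by (intro ge_one_powr_ge_zero) auto
    also have "\<dots> = K * 2 powr - s" by (simp add: K_def flip: powr_add)
    also have "\<dots> \<le> K * \<epsilon> powr - s"
      using \<epsilon> assms(1) by (intro mult_left_mono powr_mono2') (auto simp: K_def)
    finally show ?thesis using True by simp
  next
    case False
    define k where "k = level r"
    \<comment> \<open>The index \<open>k + n\<close> is the last one before the level of
      \<open>\<epsilon> * r\<close>, so its radius still exceeds \<open>\<epsilon> * r\<close>. This
      bounds \<open>\<epsilon>\<close> by a quotient of two radii, to which the hypothesis on
      \<open>p\<close> applies.\<close>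
    obtain n where n: "level (\<epsilon> * r) = Suc (k + n)"
      using less_imp_Suc_add[of k "level (\<epsilon> * r)"] False by (auto simp: k_def not_le)
    have "\<epsilon> * radius k \<le> \<epsilon> * r"
      using \<epsilon> radius_le_iff_level_le[OF r, of k] by (simp add: k_def)
    also have "\<dots> < radius (k + n)"
    proof (rule ccontr)
      assume "\<not> \<epsilon> * r < radius (k + n)"
      then show False using radius_le_iff_level_le[of "\<epsilon> * r" "k + n"] \<epsilon> r n by simp
    qed
    finally have "\<epsilon> \<le> radius (k + n) / radius k"
      using radius_pos[of k] by (simp add: field_simps)
    also have "\<dots> = 2 powr (p k - p (k + n))" unfolding radius_def powr_diff[symmetric] by simp
    finally have "(2 powr (p k - p (k + n))) powr - s \<le> \<epsilon> powr - s"
      using \<epsilon> assms(1) by (intro powr_mono2') auto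
    then have eps: "2 powr (s * (p (k + n) - p k)) \<le> \<epsilon> powr - s"
      by (simp add: powr_powr algebra_simps)
    have "2 ^ (level (\<epsilon> * r) - level r) = 2 powr (1 + real n)"
      using n by (simp add: k_def powr_add powr_realpow)
    also have "\<dots> \<le> 2 powr ((1 + C + s) + s * (p (k + n) - p k))"
      using assms(3)[of n k] assms(1) by (intro powr_mono) auto
    also have "\<dots> = K * 2 powr (s * (p (k + n) - p k))" unfolding K_def powr_add ..
    also have "\<dots> \<le> K * \<epsilon> powr - s"
      using eps by (intro mult_left_mono) (auto simp: K_def)
    finally show ?thesis .
  qed
  have "ennreal_of_enat (covering_number cmetric \<epsilon>) \<le> ennreal (K * \<epsilon> powr - s)"
    if \<epsilon>: "\<epsilon> \<in> {0<..<2}" for \<epsilon>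
  proof -
    \<comment> \<open>The numbers of balls are integers, so the real bound may be rounded
      down.\<close>
    define N where "N = nat \<lfloor>K * \<epsilon> powr - s\<rfloor>"
    have "2 ^ (level (\<epsilon> * r) - level r) \<le> N" if "r > 0" for r
      unfolding N_def by (rule le_nat_floor) (use bound[of \<epsilon> r] \<epsilon> that in simp)
    then have "covering_number cmetric \<epsilon> \<le> enat N"
      using \<epsilon> by (intro covering_number_le) auto
    then have "ennreal_of_enat (covering_number cmetric \<epsilon>) \<le> ennreal_of_enat (enat N)"
      by (simp only: ennreal_of_enat_le_iff)
    also have "\<dots> = ennreal (real N)" by (simp add: ennreal_of_nat_eq_real_of_nat)
    also have "\<dots> \<le> ennreal (K * \<epsilon> powr - s)"
      by (intro ennreal_leI) (simp add: N_def K_def)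
    finally show ?thesis .
  qed
  then show ?thesis
    unfolding assouad_dim_def using assms(1)
    by (intro Inf_lower CollectI exI[of _ s] exI[of _ K] conjI refl ballI) (auto simp: K_def)
qed

text \<open>The test ball is the cylinder of length \<open>j\<close> around the constant sequence.
  It contains \<open>2 ^ n\<close> prefixes of length \<open>j + n\<close>, and a ball of radius
  \<open>radius (j + n)\<close> meets only one of them.\<close>

lemma covering_number_ge:
  "enat (2 ^ n) \<le> covering_number cmetric (radius (j + n) / radius j)"
  unfolding covering_number_def
proof (rule Inf_greatest, clarify)
  fix N
  assume N: "\<forall>x\<in>mspace cmetric. \<forall>r>0. \<exists>C\<subseteq>mspace cmetric. finite C \<and> card C \<le> N \<and>
    mcball_of cmetric x r \<subseteq> (\<Union>c\<in>C. mcball_of cmetric c (radius (j + n) / radius j * r))"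
  have "ternary (\<lambda>_. False) \<in> mspace cmetric" by (simp add: mspace_cmetric)
  from N[rule_format, OF this radius_pos[of j]] obtain C where C: "C \<subseteq> mspace cmetric" "finite C" "card C \<le> N"
    "mcball_of cmetric (ternary (\<lambda>_. False)) (radius j)
      \<subseteq> (\<Union>c\<in>C. mcball_of cmetric c (radius (j + n) / radius j * radius j))"
    by (elim exE conjE)
  have "\<forall>A\<in>Pow {j..<j + n}. \<exists>c. ternary c \<in> C \<and> (\<lambda>i. i \<in> A) \<in> cylinder c (j + n)"
  proof
    fix A assume A: "A \<in> Pow {j..<j + n}"
    then have "(\<lambda>i. i \<in> A) \<in> cylinder (\<lambda>_. False) j" by (auto simp: cylinder_def)
    then have "ternary (\<lambda>i. i \<in> A) \<in> mcball_of cmetric (ternary (\<lambda>_. False)) (radius j)"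
      by (simp add: mspace_cmetric mdist_cmetric cdist_le_radius_iff)
    with C(4) obtain x where x: "x \<in> C" "ternary (\<lambda>i. i \<in> A) \<in> mcball_of cmetric x (radius (j + n))"
      using radius_pos[of j] by auto
    with C(1) obtain c where "x = ternary c" by (auto simp: mspace_cmetric)
    with x show "\<exists>c. ternary c \<in> C \<and> (\<lambda>i. i \<in> A) \<in> cylinder c (j + n)"
      by (auto simp: mdist_cmetric cdist_le_radius_iff)
  qed
  from bchoice[OF this] obtain g where g: "\<And>A. A \<subseteq> {j..<j + n} \<Longrightarrow> ternary (g A) \<in> C"
    "\<And>A. A \<subseteq> {j..<j + n} \<Longrightarrow> (\<lambda>i. i \<in> A) \<in> cylinder (g A) (j + n)" by auto
  \<comment> \<open>A chosen centre determines the first \<open>j + n\<close> entries of every point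
    in its ball, hence the set \<open>A\<close>.\<close>
  have "inj_on (\<lambda>A. ternary (g A)) (Pow {j..<j + n})"
  proof (intro inj_onI)
    fix A B assume AB: "A \<in> Pow {j..<j + n}" "B \<in> Pow {j..<j + n}" "ternary (g A) = ternary (g B)"
    then have "g A = g B" by (simp add: inj_eq[OF inj_ternary])
    moreover have "(\<lambda>i. i \<in> A) \<in> cylinder (g A) (j + n)" "(\<lambda>i. i \<in> B) \<in> cylinder (g B) (j + n)"
      using g(2) AB by auto
    ultimately have "i \<in> A \<longleftrightarrow> i \<in> B" if "i < j + n" for i
      using that by (simp add: cylinder_def)
    with AB show "A = B" by fastforce
  qed
  then have "card (Pow {j..<j + n}) \<le> card C"
    using g(1) C(2) by (intro card_inj_on_le) auto
  then show "enat (2 ^ n) \<le> enat N" using C(3) by (simp add: card_Pow)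
qed

text \<open>If some \<open>t < s\<close> were admissible with constant \<open>K\<close>, the scales
  \<open>radius (j + n) / radius j\<close> would give
  \<open>2 ^ n \<le> K * 2 powr (t / s * n)\<close>. This fails for large \<open>n\<close>, and the
  hypothesis supplies suitable windows of arbitrarily large length.\<close>

lemma assouad_dim_ge:
  assumes "0 < s" "\<And>m. \<exists>n\<ge>m. \<exists>j. s * (p (j + n) - p j) \<le> real n"
  shows "ennreal s \<le> assouad_dim cmetric"
  unfolding assouad_dim_def
proof (rule Inf_greatest, clarify, rule ccontr)
  fix t K :: real
  assume t: "0 < t" "\<not> ennreal s \<le> ennreal t" and "K > 0"
    and K: "\<forall>\<epsilon>\<in>{0<..<2}. ennreal_of_enat (covering_number cmetric \<epsilon>) \<le> ennreal (K * \<epsilon> powr - t)"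
  define d where "d = 1 - t / s"
  have "d > 0" using t assms(1) by (auto simp: d_def not_le ennreal_less_iff)
  then have "filterlim (\<lambda>n. 2 powr (d * real n)) at_top sequentially" by real_asymp
  then have "\<forall>\<^sub>F n in sequentially. K < 2 powr (d * real n)"
    by (simp add: filterlim_at_top_dense)
  then obtain m where m: "\<And>n. n \<ge> m \<Longrightarrow> K < 2 powr (d * real n)"
    by (auto simp: eventually_sequentially)
  obtain n j where n: "n \<ge> m" "s * (p (j + n) - p j) \<le> real n" using assms(2) by blast
  define \<epsilon> where "\<epsilon> = radius (j + n) / radius j"
  have "radius (j + n) \<le> radius j" by simp
  then have "\<epsilon> \<in> {0<..<2}"
    using radius_pos[of j] radius_pos[of "j + n"]
    by (auto simp: \<epsilon>_def divide_less_eq_1 pos_divide_less_eq simp del: radius_le_iff radius_less_iff)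
  have "ennreal (2 ^ n) = ennreal_of_enat (enat (2 ^ n))"
    by (simp add: ennreal_of_nat_eq_real_of_nat)
  also have "\<dots> \<le> ennreal_of_enat (covering_number cmetric \<epsilon>)"
    unfolding ennreal_of_enat_le_iff \<epsilon>_def by (rule covering_number_ge)
  also have "\<dots> \<le> ennreal (K * \<epsilon> powr - t)" using K \<open>\<epsilon> \<in> {0<..<2}\<close> by blast
  finally have "2 ^ n \<le> K * \<epsilon> powr - t"
    using \<open>K > 0\<close> by (simp add: ennreal_le_iff)
  also have "\<epsilon> = 2 powr (p j - p (j + n))" unfolding \<epsilon>_def radius_def powr_diff[symmetric] by simp
  also have "(2 powr (p j - p (j + n))) powr - t = 2 powr (t * (p (j + n) - p j))"
    by (simp add: powr_powr algebra_simps)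
  finally have le: "2 powr real n \<le> K * 2 powr (t * (p (j + n) - p j))" by (simp add: powr_realpow)
  have "t * (p (j + n) - p j) = t / s * (s * (p (j + n) - p j))" using assms(1) by simp
  also have "\<dots> \<le> t / s * real n" using n(2) t(1) assms(1) by (intro mult_left_mono) auto
  finally have "2 powr (t * (p (j + n) - p j)) \<le> 2 powr (t / s * real n)" by simp
  then have "K * 2 powr (t * (p (j + n) - p j)) \<le> K * 2 powr (t / s * real n)"
    using \<open>K > 0\<close> by (intro mult_left_mono) auto
  with le have "2 powr real n \<le> K * 2 powr (t / s * real n)" by linarith
  also have "\<dots> < 2 powr (d * real n) * 2 powr (t / s * real n)"
    using m[OF n(1)] by (intro mult_strict_right_mono) auto
  also have "\<dots> = 2 powr real n" by (simp add: d_def algebra_simps flip: powr_add)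
  finally show False by simp
qed

end

section \<open>The increments of the exponent\<close>

text \<open>Truncation of \<open>x\<close> to the interval from \<open>1 / (k + 1)\<close> to \<open>k + 1\<close>: it treats the values \<open>0\<close> and
  \<open>\<infinity>\<close> along with the others, and keeps the series of increments divergent.\<close>

definition rate :: "ennreal \<Rightarrow> nat \<Rightarrow> real" where
  "rate x k = max (1 / (real k + 1)) (enn2real (min x (ennreal (real k + 1))))"

lemma rate_pos: "rate x k > 0"
  unfolding rate_def less_max_iff_disj by simp

lemma rate_le_Suc: "rate x k \<le> real k + 1"
proof -
  have "enn2real (min x (ennreal (real k + 1))) \<le> real k + 1"
    by (intro enn2real_leI) auto
  moreover have "1 / (real k + 1) \<le> real k + 1" by (simp add: divide_le_eq algebra_simps)
  ultimately show ?thesis by (simp add: rate_def)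
qed

lemma rate_mono: "x \<le> y \<Longrightarrow> rate x k \<le> rate y k"
  unfolding rate_def
  by (intro max.mono order_refl enn2real_mono min.mono) (auto simp: min_less_iff_disj)

text \<open>Together with its counterpart \<open>eventually_rate_le\<close> this says that
  \<open>rate x\<close> converges to \<open>x\<close> in \<open>[0, \<infinity>]\<close>.\<close>

lemma eventually_le_rate:
  assumes "ennreal s < x"
  shows "\<forall>\<^sub>F k in sequentially. s \<le> rate x k"
proof -
  have "\<forall>\<^sub>F k in sequentially. s \<le> real k + 1" by real_asymp
  then show ?thesis
  proof eventually_elim
    case (elim k)
    show ?case
    proof (cases "s \<ge> 0")
      case True
      have "enn2real (ennreal s) \<le> enn2real (min x (ennreal (real k + 1)))"
        using assms elim
        by (intro enn2real_mono) (simp_all only: min.bounded_iff ennreal_leI less_imp_le,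
          simp_all add: min_less_iff_disj)
      then show ?thesis using True by (simp add: rate_def)
    next
      case False
      then show ?thesis using rate_pos[of x k] by linarith
    qed
  qed
qed

lemma eventually_rate_le:
  assumes "x < ennreal s"
  shows "\<forall>\<^sub>F k in sequentially. rate x k \<le> s"
proof -
  have "s > 0" using assms by (metis ennreal_neg not_le not_less_zero)
  then have "\<forall>\<^sub>F k in sequentially. 1 / (real k + 1) \<le> s" by real_asymp
  then show ?thesis
  proof eventually_elim
    case (elim k)
    have "enn2real (min x (ennreal (real k + 1))) \<le> s"
      using \<open>s > 0\<close> assms by (intro enn2real_leI) (auto simp: min_le_iff_disj)
    with elim show ?case by (simp add: rate_def)
  qed
qed

definition blocks :: "nat set" where
  "blocks = (\<Union>n. {2 ^ n..<2 ^ n + n})"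

text \<open>Only blocks with index below \<open>n\<close> begin before \<open>2 ^ n\<close>, and
  each is shorter than \<open>n\<close>. The bound is negligible against
  \<open>2 ^ n\<close>.\<close>

lemma card_blocks_le: "card ({..<2 ^ n} \<inter> blocks) \<le> n * n"
proof -
  have "{..<2 ^ n} \<inter> blocks \<subseteq> (\<Union>m<n. {2 ^ m..<2 ^ m + m})"
  proof
    fix i assume "i \<in> {..<2 ^ n} \<inter> blocks"
    then obtain m where m: "i < 2 ^ n" "i \<in> {2 ^ m..<2 ^ m + m}" by (auto simp: blocks_def)
    then have "2 ^ m \<le> i" by simp
    also note m(1)
    finally have "m < n" by simp
    with m show "i \<in> (\<Union>m<n. {2 ^ m..<2 ^ m + m})" by auto
  qed
  then have "card ({..<2 ^ n} \<inter> blocks) \<le> card (\<Union>m<n. {2 ^ m..<2 ^ m + m})"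
    by (intro card_mono) auto
  also have "\<dots> \<le> (\<Sum>m<n. card {2 ^ m..<2 ^ m + m})" by (intro card_UN_le) auto
  also have "\<dots> \<le> (\<Sum>m<n. n)" by (intro sum_mono) auto
  finally show ?thesis by simp
qed

text \<open>With reciprocals as increments, \<open>k / exponent a b k\<close> is the harmonic mean
  of the first \<open>k\<close> rates, and likewise over any window.\<close>

definition step :: "ennreal \<Rightarrow> ennreal \<Rightarrow> nat \<Rightarrow> real" where
  "step a b i = 1 / rate (if i \<in> blocks then b else a) i"

section \<open>Growth of the exponent\<close>

definition exponent :: "ennreal \<Rightarrow> ennreal \<Rightarrow> nat \<Rightarrow> real" where
  "exponent a b k = (\<Sum>i<k. step a b i)"

lemma step_pos: "step a b i > 0"
  by (simp add: step_def rate_pos)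

lemma exponent_diff: "exponent a b (j + n) - exponent a b j = (\<Sum>i=j..<j + n. step a b i)"
  unfolding exponent_def lessThan_atLeast0
  using sum.atLeastLessThan_concat[of 0 j "j + n" "step a b"] by simp

lemma cantor_ultrametric_exponent: "cantor_ultrametric (exponent a b)"
proof
  show "strict_mono (exponent a b)"
    by (rule strict_monoI_Suc) (simp add: exponent_def step_pos)
  \<comment> \<open>The truncation \<open>rate x i \<le> i + 1\<close> makes the exponent dominate
    the harmonic series, even when \<open>a\<close> or \<open>b\<close> is infinite.\<close>
  have "harm k \<le> exponent a b k" for k
  proof -
    have "harm k = (\<Sum>i<k. 1 / (real i + 1))"
      by (induction k) (simp_all add: harm_Suc harm_expand(1) inverse_eq_divide add.commute)
    also have "\<dots> \<le> exponent a b k"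
      unfolding exponent_def step_def
      by (intro sum_mono divide_left_mono rate_le_Suc mult_pos_pos rate_pos) auto
    finally show ?thesis .
  qed
  then show "filterlim (exponent a b) at_top sequentially"
    by (intro filterlim_at_top_mono[OF harm_at_top]) auto
qed

text \<open>Since \<open>a \<le> b\<close>, all rates, inside the blocks or not, are at least
  \<open>s\<close> from some index on, so each later increment contributes at most 1. The constant
  \<open>C\<close> collects the finitely many earlier ones.\<close>

lemma exponent_upper:
  assumes "a \<le> b" "ennreal s < a" "0 \<le> s"
  obtains C where "0 \<le> C" "\<And>k. s * exponent a b k \<le> real k + C"
proof -
  obtain m where m: "\<And>i. i \<ge> m \<Longrightarrow> s \<le> rate a i"
    using eventually_le_rate[OF assms(2)] by (auto simp: eventually_sequentially)
  have step: "s * step a b i \<le> 1" if "i \<ge> m" for i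
  proof -
    have "s \<le> rate (if i \<in> blocks then b else a) i"
      using m[OF that] rate_mono[OF assms(1), of i] by auto
    then show ?thesis using rate_pos by (simp add: step_def)
  qed
  have nonneg: "0 \<le> s * step a b i" for i using assms(3) step_pos[of a b i] by simp
  have "s * exponent a b k \<le> real k + (\<Sum>i<m. s * step a b i)" for k
  proof -
    have "s * exponent a b k = (\<Sum>i<k. s * step a b i)"
      by (simp add: exponent_def sum_distrib_left)
    also have "\<dots> \<le> (\<Sum>i<k. 1 + (if i \<in> {..<m} then s * step a b i else 0))"
      using step by (intro sum_mono) (simp add: not_less)
    also have "\<dots> = real k + (\<Sum>i\<in>{..<k} \<inter> {..<m}. s * step a b i)"
      by (simp only: sum.distrib sum.inter_restrict finite_lessThan) simp
    also have "\<dots> \<le> real k + (\<Sum>i<m. s * step a b i)"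
      using nonneg by (intro add_left_mono sum_mono2) auto
    finally show ?thesis .
  qed
  then show ?thesis using nonneg by (intro that[of "\<Sum>i<m. s * step a b i"] sum_nonneg) auto
qed

text \<open>The witnesses are powers of two. Below \<open>2 ^ n\<close> all but
  \<open>l + n * n\<close> indices have rate at most \<open>t\<close>, and the gap between
  \<open>t\<close> and \<open>s\<close> absorbs these exceptions.\<close>

lemma exponent_frequently_ge:
  assumes "a < ennreal s"
  shows "\<exists>k\<ge>m. real k \<le> s * exponent a b k"
proof -
  obtain t where t: "0 \<le> t" "a < ennreal t" "t < s"
  proof -
    obtain y where y: "a < y" "y < ennreal s" using assms dense by blast
    have "y < top" using y(2) ennreal_less_top by (rule less_trans)
    then have "ennreal (enn2real y) = y" by simp
    with y show ?thesis using that[of "enn2real y"] by (simp flip: ennreal_less_iff)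
  qed
  obtain l where l: "\<And>i. i \<ge> l \<Longrightarrow> rate a i \<le> t"
    using eventually_rate_le[OF t(2)] by (auto simp: eventually_sequentially)
  define c where "c = t / s"
  have c: "0 \<le> c" "c < 1" using t by (auto simp: c_def)
  then have "\<forall>\<^sub>F n in sequentially. c * 2 ^ n \<le> 2 ^ n - real l - real n * real n" by real_asymp
  then have "\<forall>\<^sub>F n in sequentially. m \<le> n \<and> c * 2 ^ n \<le> 2 ^ n - real l - real n * real n"
    by (intro eventually_conj eventually_ge_at_top)
  then obtain n where n: "n \<ge> m" "c * 2 ^ n \<le> 2 ^ n - real l - real n * real n"
    using eventually_happens'[OF sequentially_bot] by blast
  have "2 ^ n - real l - real n * real n \<le> t * exponent a b (2 ^ n)"
  proof -
    have "real (card ({..<2 ^ n} \<inter> {..<l})) \<le> real (card {..<l})"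
      by (intro of_nat_mono card_mono) auto
    moreover have "real (card ({..<2 ^ n} \<inter> blocks)) \<le> real (n * n)"
      using card_blocks_le by (simp only: of_nat_le_iff)
    ultimately have "2 ^ n - real l - real n * real n
        \<le> 2 ^ n - real (card ({..<2 ^ n} \<inter> {..<l})) - real (card ({..<2 ^ n} \<inter> blocks))" by simp
    \<comment> \<open>The summand is 1 at ordinary indices and at most 0 at exceptional ones, where
      only positivity of the increment is available.\<close>
    also have "\<dots> = (\<Sum>i<2 ^ n. 1 - of_bool (i \<in> {..<l}) - of_bool (i \<in> blocks))"
      by (simp add: sum_subtractf lessThan_def)
    also have "\<dots> \<le> (\<Sum>i<2 ^ n. t * step a b i)"
    proof (intro sum_mono)
      fix i
      show "1 - of_bool (i \<in> {..<l}) - of_bool (i \<in> blocks) \<le> t * step a b i"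
      proof (cases "i < l \<or> i \<in> blocks")
        case True
        then show ?thesis using mult_nonneg_nonneg[OF t(1) less_imp_le[OF step_pos[of a b i]]]
          by (auto simp: of_bool_def)
      next
        case False
        then show ?thesis using l[of i] rate_pos[of a i] by (simp add: step_def)
      qed
    qed
    finally show ?thesis by (simp add: exponent_def sum_distrib_left)
  qed
  with n(2) have "c * 2 ^ n \<le> t * exponent a b (2 ^ n)" by linarith
  then have "t * real (2 ^ n) \<le> t * (s * exponent a b (2 ^ n))"
    using t by (simp add: c_def field_simps)
  moreover have "t > 0" using t(2) by (metis ennreal_neg not_le not_less_zero)
  ultimately have "real (2 ^ n) \<le> s * exponent a b (2 ^ n)" by simp
  moreover have "m \<le> 2 ^ n" using n(1) less_exp[of n] by linarith
  ultimately show ?thesis by blast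
qed

text \<open>Since \<open>a \<le> b\<close>, all rates are at most \<open>s\<close> from some index
  \<open>m\<close> on. A window contains at most \<open>m\<close> earlier indices wherever it
  begins, so \<open>C = m\<close> works uniformly in \<open>j\<close>.\<close>

lemma exponent_diff_lower:
  assumes "a \<le> b" "b < ennreal s"
  obtains C where "0 \<le> C" "\<And>j n. real n \<le> s * (exponent a b (j + n) - exponent a b j) + C"
proof -
  obtain m where m: "\<And>i. i \<ge> m \<Longrightarrow> rate b i \<le> s"
    using eventually_rate_le[OF assms(2)] by (auto simp: eventually_sequentially)
  have "s > 0" using assms(2) by (metis ennreal_neg not_le not_less_zero)
  have step: "1 - of_bool (i \<in> {..<m}) \<le> s * step a b i" for i
  proof (cases "i < m")
    case True
    then show ?thesis using \<open>s > 0\<close> step_pos[of a b i] by simp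
  next
    case False
    then have "rate (if i \<in> blocks then b else a) i \<le> s"
      using m[of i] rate_mono[OF assms(1), of i] by auto
    then show ?thesis using False rate_pos by (simp add: step_def)
  qed
  have "real n \<le> s * (exponent a b (j + n) - exponent a b j) + real m" for j n
  proof -
    have "real (card ({j..<j + n} \<inter> {..<m})) \<le> real (card {..<m})"
      by (intro of_nat_mono card_mono) auto
    then have "real n - real m \<le> real n - real (card ({j..<j + n} \<inter> {..<m}))" by simp
    also have "\<dots> = (\<Sum>i=j..<j + n. 1 - of_bool (i \<in> {..<m}))" by (simp add: sum_subtractf lessThan_def)
    also have "\<dots> \<le> (\<Sum>i=j..<j + n. s * step a b i)" by (intro sum_mono step)
    also have "\<dots> = s * (exponent a b (j + n) - exponent a b j)"
      by (simp add: exponent_diff sum_distrib_left)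
    finally show ?thesis by simp
  qed
  then show ?thesis by (intro that[of "real m"]) auto
qed

text \<open>The window is the block beginning at \<open>2 ^ n\<close>: all its rates are those of
  \<open>b\<close>, and for \<open>n \<ge> l\<close> it lies beyond \<open>l\<close>, where they are
  at least \<open>s\<close>.\<close>

lemma exponent_diff_frequently_le:
  assumes "ennreal s < b"
  shows "\<exists>n\<ge>m. \<exists>j. s * (exponent a b (j + n) - exponent a b j) \<le> real n"
proof -
  obtain l where l: "\<And>i. i \<ge> l \<Longrightarrow> s \<le> rate b i"
    using eventually_le_rate[OF assms] by (auto simp: eventually_sequentially)
  define n where "n = max l m"
  have "s * (exponent a b (2 ^ n + n) - exponent a b (2 ^ n)) = (\<Sum>i=2 ^ n..<2 ^ n + n. s * step a b i)"
    by (simp add: exponent_diff sum_distrib_left)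
  also have "\<dots> \<le> (\<Sum>i=2 ^ n..<2 ^ n + n. 1)"
  proof (intro sum_mono)
    fix i assume i: "i \<in> {2 ^ n..<2 ^ n + n}"
    have "l \<le> n" by (simp add: n_def)
    also have "n < 2 ^ n" by (rule less_exp)
    finally have "s \<le> rate b i" using i by (intro l) auto
    moreover have "i \<in> blocks" using i by (auto simp: blocks_def)
    ultimately show "s * step a b i \<le> 1" using rate_pos[of b i] by (simp add: step_def)
  qed
  also have "\<dots> = real n" by simp
  finally show ?thesis by (intro exI[of _ n] conjI exI[of _ "2 ^ n"]) (auto simp: n_def)
qed

section \<open>Both dimensions of the constructed space\<close>

theorem theorem1p3:
  fixes a b :: ennreal
  assumes "a \<le> b"
  shows "\<exists>m :: real metric.
           cantor_metric_space m \<and> hausdorff_dim m = a \<and> assouad_dim m = b"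
proof -
  interpret cantor_ultrametric "exponent a b" by (rule cantor_ultrametric_exponent)
  have "hausdorff_dim cmetric \<le> a"
  \<comment> \<open>Only finite values strictly beyond the endpoint are tested, so
    \<open>a = 0\<close> and \<open>a = \<infinity>\<close> require no separate treatment. The same
    device serves the two Assouad bounds.\<close>
  proof (rule dense_ge)
    fix y assume y: "a < y"
    show "hausdorff_dim cmetric \<le> y"
    proof (cases y)
      case (real s)
      with y have "s > 0" by (metis ennreal_neg not_le not_less_zero)
      then show ?thesis
        unfolding real using exponent_frequently_ge y real by (intro hausdorff_dim_le) auto
    qed simp
  qed
  moreover have "a \<le> hausdorff_dim cmetric"
    unfolding hausdorff_dim_def
  proof (rule Inf_greatest, clarify, rule ccontr)
    fix s assume s: "0 \<le> s" "hausdorff_measure cmetric s (mspace cmetric) = 0" "\<not> a \<le> ennreal s"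
    then have "ennreal s < a" by simp
    then obtain C where "0 \<le> C" "\<And>k. s * exponent a b k \<le> real k + C"
      using exponent_upper[OF assms _ s(1)] by blast
    with s show False using hausdorff_measure_nonzero by blast
  qed
  moreover have "assouad_dim cmetric \<le> b"
  proof (rule dense_ge)
    fix y assume y: "b < y"
    show "assouad_dim cmetric \<le> y"
    proof (cases y)
      case (real s)
      with y have "s > 0" by (metis ennreal_neg not_le not_less_zero)
      obtain C where "0 \<le> C" "\<And>j n. real n \<le> s * (exponent a b (j + n) - exponent a b j) + C"
        using exponent_diff_lower[OF assms] y real by blast
      with \<open>s > 0\<close> show ?thesis unfolding real by (rule assouad_dim_le)
    qed simp
  qed
  moreover have "b \<le> assouad_dim cmetric"
  proof (rule dense_le)
    fix y assume y: "y < b"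
    show "y \<le> assouad_dim cmetric"
    proof (cases y)
      case (real s)
      show ?thesis
      \<comment> \<open>The lower bound for the Assouad dimension is available for positive
        \<open>s\<close> only; for \<open>s = 0\<close> the claim is trivial.\<close>
      proof (cases "s = 0")
        case False
        with real have "s > 0" by simp
        then show ?thesis
          unfolding real using exponent_diff_frequently_le y real by (intro assouad_dim_ge) auto
      qed (simp add: real)
    qed (use y in simp)
  qed
  ultimately show ?thesis using cantor_metric_space_cmetric by (intro exI[of _ cmetric]) auto
qed

end
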